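(* Consider a connected power network with nodes $i=1,\dots,I$, demands $D_i\ge0$, and generators $n=1,\dots,N$ with cost functions $c_n$. Assume: (1) the feasible dispatch set remains non-empty if any one of the generators is excluded, i.e. for each generator $n_0$ there is a feasible point of the economic dispatch problem with $x_{n_0}=0$; (2) (monopoly-free condition) there are at least two generators at each node. Then there exists an efficient Nash equilibrium in the LMP game.
   Context: Network: a connected power network with nodes $i=1,\dots,I$; line $i$-$j$ has admittance $Y_{ij}=Y_{ji}>0$ ($Y_{ij}=0$ if there is no line) and capacity $C_{ij}=C_{ji}>0$. There are generators $n=1,\dots,N$; $\mathcal N_i$ is the set of generators at node $i$; generator $n$ has cost function $c_n:\mathbb R_+\to\mathbb R_+$ with $c_n(0)=0$, $c_n'\ge 0$, $c_n''\ge 0$. Node $i$ has inelastic demand $D_i\ge 0$. Economic dispatch problem: minimize $\sum_n c_n(x_n)$ over $x_n,\theta_i\in\mathbb R$ subject to $\sum_{n\in\mathcal N_i}x_n-D_i=\sum_jY_{ij}(\theta_i-\theta_j)$ for all $i$ (power balance); $Y_{ij}(\theta_i-\theta_j)\le C_{ij}$ for all ordered pairs $(i,j)$ joined by a line (line flow); $x_n\ge0$ for all $n$. LMP game. Each generator $n$ submits a bid $(p_n,s_n,q_n)$ with $0\le p_n\le q_n$, $s_n\ge0$, identified with the function $b_n(x_n)=p_nx_n$ for $x_n\le s_n$ and $b_n(x_n)=q_nx_n+(p_n-q_n)s_n$ for $x_n>s_n$. Given the bid profile $b=(b_1,\dots,b_N)$, the dispatch $x$ is (the $x$-part of) an optimal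 solution $(x,\theta)$ of the economic dispatch problem with each $c_n$ replaced by $b_n$. The locational marginal prices (LMPs) $\pi=(\pi_1,\dots,\pi_I)$ are the optimal Lagrange multipliers of the power balance equalities in that problem: there are multipliers $\mu_{ij}\ge0$ for the line constraints such that for $n\in\mathcal N_i$: $\pi_i$ lies between the left and right derivatives of $b_n$ at $x_n$ if $x_n>0$, and $\pi_i$ is at most the right derivative of $b_n$ at $0$ if $x_n=0$; $\sum_jY_{ij}(\pi_i-\pi_j+\mu_{ij}-\mu_{ji})=0$ for all $i$; and $\mu_{ij}[Y_{ij}(\theta_i-\theta_j)-C_{ij}]=0$ for all $(i,j)$. If the optimal $\pi$ is not unique, ties are broken by choosing the lexicographically smallest one (first minimize $\pi_1$, then $\pi_2$, and so on). If the optimal $x$ is not unique, any optimal $x$ may be the dispatch associated with $b$. The pair $(x,\pi)$ is an outcome associated with $b$. The payoff of generator $n\in\mathcal N_i$ is $u_n=\pi_ix_n-c_n(x_n)$. A (pure) Nash equilibrium is a bid profile $b$ together with an associated outcome $(x,\pi)$ such that no generator can be strictly better off by a unilateral change of his bid (for no generator $n$ and no alternative bid of $n$ does an outcome associated with the changed profile give $n$ a strictly larger payoff). It is efficient if $x$ also solves the economic dispatch problem (with the true costs $c_n$).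
   Formalization: If all demands are zero, the optimal multipliers are unbounded below and no lexicographically smallest one exists, so the claim fails as written; in that case only, every optimal multiplier vector is accepted as LMPs (all payoffs are then zero). *)

theory Defs
  imports Complex_Main "HOL-Library.Fun_Lexorder"
begin

text \<open>
  Nodes are the elements of a finite linearly ordered type (the order matters only for the
  lexicographic tie-breaking of prices), generators those of a finite type. There is a line
  between \<open>i\<close> and \<open>j\<close> iff \<open>adm G i j > 0\<close>; \<open>cap G i j\<close> is meaningful only in that case.
\<close>

record ('i, 'n) network =
  adm :: "'i \<Rightarrow> 'i \<Rightarrow> real"
  cap :: "'i \<Rightarrow> 'i \<Rightarrow> real"
  dem :: "'i \<Rightarrow> real"
  loc :: "'n \<Rightarrow> 'i"

definition line :: "('i, 'n) network \<Rightarrow> 'i \<Rightarrow> 'i \<Rightarrow> bool" where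
  "line G i j \<longleftrightarrow> adm G i j > 0"

definition generators_at :: "('i, 'n) network \<Rightarrow> 'i \<Rightarrow> 'n set" where
  "generators_at G i = {n. loc G n = i}"

definition connected_power_network :: "('i, 'n) network \<Rightarrow> bool" where
  "connected_power_network G \<longleftrightarrow>
     (\<forall>i j. adm G i j \<ge> 0 \<and> adm G i j = adm G j i) \<and>
     (\<forall>i. adm G i i = 0) \<and>
     (\<forall>i j. line G i j \<longrightarrow> cap G i j > 0 \<and> cap G i j = cap G j i) \<and>
     (\<forall>i j. (line G)\<^sup>*\<^sup>* i j) \<and>
     (\<forall>i. dem G i \<ge> 0)"

definition cost_function :: "(real \<Rightarrow> real) \<Rightarrow> bool" where
  "cost_function c \<longleftrightarrow>
     c 0 = 0 \<and> (\<forall>x\<ge>0. c x \<ge> 0) \<and>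
     (\<exists>c' c''. \<forall>x\<ge>0. (c has_real_derivative c' x) (at x within {0..}) \<and>
                     (c' has_real_derivative c'' x) (at x within {0..}) \<and>
                     c' x \<ge> 0 \<and> c'' x \<ge> 0)"

definition feasible ::
  "('i::finite, 'n::finite) network \<Rightarrow> ('n \<Rightarrow> real) \<Rightarrow> ('i \<Rightarrow> real) \<Rightarrow> bool" where
  "feasible G x \<theta> \<longleftrightarrow>
     (\<forall>i. (\<Sum>n\<in>generators_at G i. x n) - dem G i = (\<Sum>j\<in>UNIV. adm G i j * (\<theta> i - \<theta> j))) \<and>
     (\<forall>i j. line G i j \<longrightarrow> adm G i j * (\<theta> i - \<theta> j) \<le> cap G i j) \<and>
     (\<forall>n. x n \<ge> 0)"

definition optimal_dispatch ::
  "('i::finite, 'n::finite) network \<Rightarrow> ('n \<Rightarrow> real \<Rightarrow> real) \<Rightarrow> ('n \<Rightarrow> real) \<Rightarrow> ('i \<Rightarrow> real) \<Rightarrow> bool"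
where
  "optimal_dispatch G f x \<theta> \<longleftrightarrow>
     feasible G x \<theta> \<and>
     (\<forall>x' \<theta>'. feasible G x' \<theta>' \<longrightarrow> (\<Sum>n\<in>UNIV. f n (x n)) \<le> (\<Sum>n\<in>UNIV. f n (x' n)))"

record bid =
  bid_p :: real
  bid_s :: real
  bid_q :: real

definition valid_bid :: "bid \<Rightarrow> bool" where
  "valid_bid \<beta> \<longleftrightarrow> 0 \<le> bid_p \<beta> \<and> bid_p \<beta> \<le> bid_q \<beta> \<and> 0 \<le> bid_s \<beta>"

definition bid_fun :: "bid \<Rightarrow> real \<Rightarrow> real" where
  "bid_fun \<beta> x =
     (if x \<le> bid_s \<beta> then bid_p \<beta> * x
      else bid_q \<beta> * x + (bid_p \<beta> - bid_q \<beta>) * bid_s \<beta>)"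

definition price_multiplier ::
  "('i::finite, 'n::finite) network \<Rightarrow> ('n \<Rightarrow> bid) \<Rightarrow> ('n \<Rightarrow> real) \<Rightarrow> ('i \<Rightarrow> real) \<Rightarrow> ('i \<Rightarrow> real) \<Rightarrow> bool"
where
  "price_multiplier G b x \<theta> \<pi> \<longleftrightarrow>
     (\<forall>n. x n > 0 \<longrightarrow>
        (\<exists>l r. (bid_fun (b n) has_real_derivative l) (at_left (x n)) \<and>
               (bid_fun (b n) has_real_derivative r) (at_right (x n)) \<and>
               l \<le> \<pi> (loc G n) \<and> \<pi> (loc G n) \<le> r)) \<and>
     (\<forall>n. x n = 0 \<longrightarrow>
        (\<exists>r. (bid_fun (b n) has_real_derivative r) (at_right 0) \<and> \<pi> (loc G n) \<le> r)) \<and>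
     (\<exists>\<mu> :: 'i \<Rightarrow> 'i \<Rightarrow> real.
        (\<forall>i j. \<mu> i j \<ge> 0) \<and>
        (\<forall>i. (\<Sum>j\<in>UNIV. adm G i j * (\<pi> i - \<pi> j + \<mu> i j - \<mu> j i)) = 0) \<and>
        (\<forall>i j. line G i j \<longrightarrow> \<mu> i j * (adm G i j * (\<theta> i - \<theta> j) - cap G i j) = 0))"

text \<open>\<open>less_fun\<close> is the strict lexicographic order on functions.\<close>

definition lex_least :: "('i::linorder \<Rightarrow> real) set \<Rightarrow> ('i \<Rightarrow> real) \<Rightarrow> bool" where
  "lex_least S \<pi> \<longleftrightarrow> \<pi> \<in> S \<and> (\<forall>\<rho>\<in>S. \<rho> = \<pi> \<or> less_fun \<pi> \<rho>)"

text \<open>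
  If every demand is zero, the only dispatch is zero and the multipliers are unbounded below
  (subtracting a constant from all prices gives another one), so none of them is
  lexicographically least. In that degenerate case every multiplier counts as a price vector;
  all payoffs are then zero whatever the prices.
\<close>

definition is_lmp ::
  "('i::{finite,linorder}, 'n::finite) network \<Rightarrow> ('n \<Rightarrow> bid) \<Rightarrow> ('n \<Rightarrow> real) \<Rightarrow> ('i \<Rightarrow> real)
    \<Rightarrow> ('i \<Rightarrow> real) \<Rightarrow> bool"
where
  "is_lmp G b x \<theta> \<pi> \<longleftrightarrow>
     (if \<forall>i. dem G i = 0 then price_multiplier G b x \<theta> \<pi>
      else lex_least {\<rho>. price_multiplier G b x \<theta> \<rho>} \<pi>)"

definition outcome ::
  "('i::{finite,linorder}, 'n::finite) network \<Rightarrow> ('n \<Rightarrow> bid) \<Rightarrow> ('n \<Rightarrow> real) \<Rightarrow> ('i \<Rightarrow> real) \<Rightarrow> bool"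
where
  "outcome G b x \<pi> \<longleftrightarrow>
     (\<exists>\<theta>. optimal_dispatch G (\<lambda>n. bid_fun (b n)) x \<theta> \<and> is_lmp G b x \<theta> \<pi>)"

definition payoff ::
  "('i, 'n) network \<Rightarrow> ('n \<Rightarrow> real \<Rightarrow> real) \<Rightarrow> ('n \<Rightarrow> real) \<Rightarrow> ('i \<Rightarrow> real) \<Rightarrow> 'n \<Rightarrow> real" where
  "payoff G c x \<pi> n = \<pi> (loc G n) * x n - c n (x n)"

definition nash_equilibrium ::
  "('i::{finite,linorder}, 'n::finite) network \<Rightarrow> ('n \<Rightarrow> real \<Rightarrow> real) \<Rightarrow> ('n \<Rightarrow> bid)
    \<Rightarrow> ('n \<Rightarrow> real) \<Rightarrow> ('i \<Rightarrow> real) \<Rightarrow> bool"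
where
  "nash_equilibrium G c b x \<pi> \<longleftrightarrow>
     (\<forall>n. valid_bid (b n)) \<and> outcome G b x \<pi> \<and>
     (\<forall>n \<beta> x' \<pi>'. valid_bid \<beta> \<and> outcome G (b(n := \<beta>)) x' \<pi>' \<longrightarrow>
        payoff G c x' \<pi>' n \<le> payoff G c x \<pi> n)"

definition efficient ::
  "('i::finite, 'n::finite) network \<Rightarrow> ('n \<Rightarrow> real \<Rightarrow> real) \<Rightarrow> ('n \<Rightarrow> real) \<Rightarrow> bool" where
  "efficient G c x \<longleftrightarrow> (\<exists>\<theta>. optimal_dispatch G c x \<theta>)"

end

theory Submission
  imports Defs "HOL-Analysis.Polytope"
begin

text \<open>
  Let \<open>x\<close> solve the dispatch problem with the true costs and let \<open>\<pi>\<close> be corresponding prices. Every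
  generator at node \<open>i\<close> bids the linear function with slope \<open>P i = max (\<pi> i) 0\<close>; the truncation only
  affects nodes without generation, since elsewhere \<open>\<pi> i\<close> is a marginal cost. By weak duality \<open>x\<close>
  remains optimal for these bids, and every price vector supporting it equals \<open>P\<close> at all nodes with
  generation, so the tie-breaking does not influence payoffs. After a deviation of generator \<open>n\<close> at
  node \<open>i\<close>, another generator at \<open>i\<close> still offers any quantity at price \<open>P i\<close>, so the new price is at
  most \<open>P i\<close>; and at price \<open>P i\<close> no quantity is more profitable to \<open>n\<close> than \<open>x n\<close>, as \<open>P i\<close> is a
  subgradient of its cost there. That a lexicographically least price vector exists follows from
  compactness of the set of price vectors.
\<close>

section \<open>Convex cones, feasible directions and convex costs\<close>

text \<open>A finitely generated cone is closed, so a point \<open>g\<close> outside it is strictly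
  separated from it by some normal \<open>a\<close>. The cone contains 0 and is closed under
  scaling, so \<open>a\<close> is non-negative on every generator. The assumption then gives
  \<open>0 \<le> g \<bullet> a\<close>, against the separation.\<close>

lemma farkas_convex_cone_hull:
  fixes S :: "'a::euclidean_space set"
  assumes "finite S"
    and "\<And>d. (\<And>v. v \<in> S \<Longrightarrow> 0 \<le> v \<bullet> d) \<Longrightarrow> 0 \<le> g \<bullet> d"
  shows "g \<in> convex_cone hull S"
proof (rule ccontr)
  assume "g \<notin> convex_cone hull S"
  then obtain a b where ab: "a \<bullet> g < b" "\<And>v. v \<in> convex_cone hull S \<Longrightarrow> b < a \<bullet> v"
    using separating_hyperplane_closed_point[OF convex_convex_cone_hull closed_convex_cone_hull[OF assms(1)]]
    by metis
  have "b < 0" using ab(2)[OF convex_cone_hull_contains_0] by simp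
  have "0 \<le> v \<bullet> a" if "v \<in> S" for v
  proof (rule ccontr)
    assume "\<not> 0 \<le> v \<bullet> a"
    hence neg: "a \<bullet> v < 0" by (simp add: inner_commute)
    \<comment> \<open>The factor is positive, being a quotient of two negative numbers, and puts
      this multiple of \<open>v\<close> exactly on the separating hyperplane.\<close>
    have "(b / (a \<bullet> v)) *\<^sub>R v \<in> convex_cone hull S"
      using neg \<open>b < 0\<close> that by (intro convex_cone_hull_mul hull_inc) (auto simp: divide_simps)
    from ab(2)[OF this] neg show False by simp
  qed
  hence "0 \<le> g \<bullet> a" by (rule assms(2))
  with ab(1) \<open>b < 0\<close> show False by (simp add: inner_commute)
qed

text \<open>Used to follow a direction for a short step: a slack inequality survives any small move,
  a tight one needs a direction of the right sign.\<close>

lemma eventually_at_right_0_nonneg: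
  fixes a d :: real
  assumes "0 \<le> a" "a = 0 \<Longrightarrow> 0 \<le> d"
  shows "eventually (\<lambda>t. 0 \<le> a + t * d) (at_right 0)"
proof (cases "a = 0")
  case True
  show ?thesis
    using eventually_at_right_less[of "0::real"]
    by (rule eventually_mono) (use True assms in auto)
next
  case False
  have "((\<lambda>t. a + t * d) \<longlongrightarrow> a + 0 * d) (at_right 0)"
    by (intro tendsto_intros)
  from order_tendstoD(1)[OF this, of 0] False assms(1) show ?thesis
    by (auto elim: eventually_mono)
qed

text \<open>A non-negative second derivative makes \<open>c'\<close> monotone, and the mean value
  theorem compares the increment of \<open>c\<close> with the slope at \<open>x\<close>. At 0 only
  one-sided derivatives are given, so both arguments differentiate at positive points only and use
  continuity at the end points.\<close>

lemma cost_function_tangent: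
  assumes "cost_function c"
  obtains c' where "continuous_on {0..} c" "continuous_on {0..} c'"
    "\<And>x. 0 \<le> x \<Longrightarrow> 0 \<le> c' x" "\<And>x y. 0 \<le> x \<Longrightarrow> 0 \<le> y \<Longrightarrow> c x + c' x * (y - x) \<le> c y"
proof -
  from assms obtain c' c'' where d: "\<And>x. 0 \<le> x \<Longrightarrow>
      (c has_real_derivative c' x) (at x within {0..}) \<and>
      (c' has_real_derivative c'' x) (at x within {0..}) \<and> c' x \<ge> 0 \<and> c'' x \<ge> 0"
    unfolding cost_function_def by auto
  have cont: "continuous_on {0..} c" "continuous_on {0..} c'"
    using d by (auto intro: DERIV_continuous_on[of _ c c'] DERIV_continuous_on[of _ c' c''])
  have at: "at x within {0..} = at x" if "0 < x" for x :: real
    using that by (intro at_within_interior) simp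
  have d0: "(c has_real_derivative c' x) (at x)" "(c' has_real_derivative c'' x) (at x)" if "0 < x" for x
    using d[of x] at[OF that] that by auto
  have mono: "c' x \<le> c' y" if "0 \<le> x" "x \<le> y" for x y
  proof (rule DERIV_nonneg_imp_increasing_open[OF that(2)])
    show "\<exists>D. (c' has_real_derivative D) (at z) \<and> 0 \<le> D" if "x < z" "z < y" for z
      using d0(2)[of z] d[of z] that \<open>0 \<le> x\<close> by (intro exI[of _ "c'' z"]) auto
    show "continuous_on {x..y} c'"
      using that by (intro continuous_on_subset[OF cont(2)]) auto
  qed
  have mvt: "\<exists>z. x < z \<and> z < y \<and> c y - c x = (y - x) * c' z" if "0 \<le> x" "x < y" for x y
  proof -
    have "continuous_on {x..y} c"
      using that by (intro continuous_on_subset[OF cont(1)]) auto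
    moreover have "c differentiable (at z)" if "x < z" "z < y" for z
      using d0(1)[of z] that \<open>0 \<le> x\<close> by (auto simp: real_differentiable_def)
    ultimately obtain l z where z: "x < z" "z < y" "DERIV c z :> l" "c y - c x = (y - x) * l"
      using MVT[OF \<open>x < y\<close>, of c] by blast
    have "l = c' z" using DERIV_unique[OF z(3) d0(1)] z(1) \<open>0 \<le> x\<close> by simp
    thus ?thesis using z by (intro exI[of _ z]) simp
  qed
  have tangent: "c x + c' x * (y - x) \<le> c y" if "0 \<le> x" "0 \<le> y" for x y
  proof (cases x y rule: linorder_cases)
    case less
    obtain z where z: "x < z" "c y - c x = (y - x) * c' z" using mvt[OF \<open>0 \<le> x\<close> less] by blast
    have "(y - x) * c' x \<le> (y - x) * c' z"
      using less z mono[of x z] that by (intro mult_left_mono) auto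
    thus ?thesis using z by (simp add: algebra_simps)
  next
    case greater
    obtain z where z: "z < x" "y < z" "c x - c y = (x - y) * c' z" using mvt[OF \<open>0 \<le> y\<close> greater] by blast
    have "(x - y) * c' z \<le> (x - y) * c' x"
      using greater z mono[of z x] that by (intro mult_left_mono) auto
    thus ?thesis using z by (simp add: algebra_simps)
  qed simp
  show ?thesis using d by (intro that[OF cont _ tangent]) simp_all
qed

section \<open>Lexicographically least points of compact sets\<close>

text \<open>The coordinates are minimised one after another in increasing order of index; each stage
  keeps a compact set of points tied so far. The induction carries a point that is lexicographically
  least as far as the coordinates in \<open>A\<close> are concerned.\<close>

lemma compact_imp_lex_least:
  fixes K :: "(real, 'i::{finite,linorder}) vec set"
  assumes "compact K" "K \<noteq> {}"
  obtains v where "lex_least ((\<lambda>v i. v $ i) ` K) (\<lambda>i. v $ i)"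
proof -
  have "\<exists>u\<in>K. \<forall>w\<in>K. (\<forall>k\<in>A. w $ k = u $ k) \<or>
      (\<exists>k\<in>A. u $ k < w $ k \<and> (\<forall>k'\<in>A. k' < k \<longrightarrow> u $ k' = w $ k'))" if "finite A" for A :: "'i set"
    using that
  proof (induction A rule: finite_linorder_max_induct)
    case empty
    show ?case using assms by auto
  next
    case (insert b A)
    then obtain u where u: "u \<in> K" "\<And>w. w \<in> K \<Longrightarrow> (\<forall>k\<in>A. w $ k = u $ k) \<or>
      (\<exists>k\<in>A. u $ k < w $ k \<and> (\<forall>k'\<in>A. k' < k \<longrightarrow> u $ k' = w $ k'))" by blast
    \<comment> \<open>Points tied with \<open>u\<close> on \<open>A\<close>. Since \<open>b\<close>
      exceeds every index in \<open>A\<close>, minimising coordinate \<open>b\<close> over them only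
      breaks these ties.\<close>
    define L where "L = K \<inter> (\<Inter>k\<in>A. {v. v $ k = u $ k})"
    have "closed {v::(real, 'i) vec. v $ k = u $ k}" for k
      by (intro closed_Collect_eq continuous_intros)
    hence "compact L"
      unfolding L_def using assms(1) by (intro compact_Int_closed closed_INT) auto
    moreover have "L \<noteq> {}" using u(1) by (auto simp: L_def)
    moreover have "continuous_on L (\<lambda>v. v $ b)" by (intro continuous_intros)
    ultimately obtain v where v: "v \<in> L" "\<And>w. w \<in> L \<Longrightarrow> v $ b \<le> w $ b"
      using continuous_attains_inf[of L "\<lambda>v. v $ b"] by blast
    have vu: "v $ k = u $ k" if "k \<in> A" for k using v(1) that by (auto simp: L_def)
    have "(\<forall>k\<in>insert b A. w $ k = v $ k) \<or>
        (\<exists>k\<in>insert b A. v $ k < w $ k \<and> (\<forall>k'\<in>insert b A. k' < k \<longrightarrow> v $ k' = w $ k'))"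
      if "w \<in> K" for w
    proof (cases "\<forall>k\<in>A. w $ k = u $ k")
      case True
      hence "v $ b \<le> w $ b" using that by (intro v(2)) (auto simp: L_def)
      hence "w $ b = v $ b \<or> v $ b < w $ b" by auto
      moreover have "\<forall>k\<in>A. w $ k = v $ k" using vu True by simp
      moreover have "b \<notin> A" using insert.hyps by auto
      ultimately show ?thesis by auto
    next
      case False
      with u(2)[OF that] obtain k where
        k: "k \<in> A" "u $ k < w $ k" "\<forall>k'\<in>A. k' < k \<longrightarrow> u $ k' = w $ k'" by blast
      have "k < b" using insert.hyps k by auto
      thus ?thesis using k vu by (intro disjI2 bexI[of _ k]) auto
    qed
    thus ?case using v(1) by (intro bexI[of _ v]) (auto simp: L_def)
  qed
  from this[of UNIV] obtain v where v: "v \<in> K" "\<And>w. w \<in> K \<Longrightarrow> (\<forall>k. w $ k = v $ k) \<or>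
      (\<exists>k. v $ k < w $ k \<and> (\<forall>k'. k' < k \<longrightarrow> v $ k' = w $ k'))"
    unfolding ball_UNIV bex_UNIV using finite[of "UNIV :: 'i set"] by blast
  have "lex_least ((\<lambda>v i. v $ i) ` K) (\<lambda>i. v $ i)"
    unfolding lex_least_def less_fun_def
  proof (intro conjI ballI)
    show "(\<lambda>i. v $ i) \<in> (\<lambda>v i. v $ i) ` K" using v(1) by (rule imageI)
    fix \<rho> assume "\<rho> \<in> (\<lambda>v i. v $ i) ` K"
    then obtain w where w: "w \<in> K" "\<rho> = (\<lambda>i. w $ i)" by blast
    show "\<rho> = (\<lambda>i. v $ i) \<or> (\<exists>k. v $ k < \<rho> k \<and> (\<forall>k'<k. v $ k' = \<rho> k'))"
      using v(2)[OF w(1)] by (simp add: w(2) fun_eq_iff)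
  qed
  thus ?thesis by (rule that)
qed

section \<open>Laplacian and congestion operators of the network\<close>

text \<open>The graph Laplacian weighted by admittances. Applied to phase angles it is the net
  outflow of a node; applied to prices it is one of the two terms of the stationarity
  equation.\<close>

definition laplacian :: "('i::finite, 'n) network \<Rightarrow> ('i \<Rightarrow> real) \<Rightarrow> 'i \<Rightarrow> real" where
  "laplacian G f i = (\<Sum>j\<in>UNIV. adm G i j * (f i - f j))"

definition net_congestion :: "('i::finite, 'n) network \<Rightarrow> ('i \<Rightarrow> 'i \<Rightarrow> real) \<Rightarrow> 'i \<Rightarrow> real" where
  "net_congestion G \<mu> i = (\<Sum>j\<in>UNIV. adm G i j * (\<mu> i j - \<mu> j i))"

text \<open>The clause of \<open>price_multiplier\<close> in which the bids do not occur, with its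
  sum split into the two operators. The same multipliers can therefore serve the true costs and the
  submitted bids.\<close>

definition line_multiplier ::
  "('i::finite, 'n) network \<Rightarrow> ('i \<Rightarrow> real) \<Rightarrow> ('i \<Rightarrow> real) \<Rightarrow> ('i \<Rightarrow> 'i \<Rightarrow> real) \<Rightarrow> bool"
where
  "line_multiplier G \<theta> \<pi> \<mu> \<longleftrightarrow>
     (\<forall>i j. \<mu> i j \<ge> 0) \<and>
     (\<forall>i. laplacian G \<pi> i + net_congestion G \<mu> i = 0) \<and>
     (\<forall>i j. line G i j \<longrightarrow> \<mu> i j * (adm G i j * (\<theta> i - \<theta> j) - cap G i j) = 0)"

lemma laplacian_add: "laplacian G (\<lambda>i. f i + g i) i = laplacian G f i + laplacian G g i"
  by (simp add: laplacian_def algebra_simps sum.distrib sum_subtractf)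

lemma laplacian_scale: "laplacian G (\<lambda>i. t * f i) i = t * laplacian G f i"
  by (simp add: laplacian_def algebra_simps sum_distrib_left sum_subtractf)

lemma net_congestion_add:
  "net_congestion G (\<lambda>i j. \<mu> i j + \<nu> i j) i = net_congestion G \<mu> i + net_congestion G \<nu> i"
  by (simp add: net_congestion_def algebra_simps sum.distrib sum_subtractf)

lemma net_congestion_scale: "net_congestion G (\<lambda>i j. t * \<mu> i j) i = t * net_congestion G \<mu> i"
  by (simp add: net_congestion_def algebra_simps sum_distrib_left sum_subtractf)

lemma sum_over_nodes:
  fixes G :: "('i::finite, 'n::finite) network"
  shows "(\<Sum>i\<in>UNIV. \<Sum>n\<in>generators_at G i. f n) = (\<Sum>n\<in>UNIV. f n)"
proof -
  have "(\<Sum>n\<in>UNIV. f n) = (\<Sum>i\<in>UNIV. sum f {n \<in> UNIV. loc G n = i})"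
    by (rule sum.group[symmetric]) auto
  thus ?thesis by (simp add: generators_at_def)
qed

locale power_network =
  fixes G :: "('i::{finite,linorder}, 'n::finite) network"
  assumes connected_power_network: "connected_power_network G"
begin

lemma adm_nonneg: "0 \<le> adm G i j"
  and adm_sym: "adm G i j = adm G j i"
  and cap_pos: "line G i j \<Longrightarrow> 0 < cap G i j"
  and connected: "(line G)\<^sup>*\<^sup>* i j"
  and dem_nonneg: "0 \<le> dem G i"
  using connected_power_network by (auto simp: connected_power_network_def)

lemma adm_eq_0: "\<not> line G i j \<Longrightarrow> adm G i j = 0"
  using adm_nonneg[of i j] by (simp add: line_def)

text \<open>Summation by parts: symmetry of \<open>adm\<close> allows the two indices to be
  exchanged in the half containing \<open>\<mu> j i\<close>.\<close>

lemma sum_net_congestion: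
  "(\<Sum>i\<in>UNIV. f i * net_congestion G \<mu> i) = (\<Sum>i\<in>UNIV. \<Sum>j\<in>UNIV. adm G i j * \<mu> i j * (f i - f j))"
proof -
  have "(\<Sum>i\<in>UNIV. f i * net_congestion G \<mu> i) =
      (\<Sum>i\<in>UNIV. \<Sum>j\<in>UNIV. adm G i j * \<mu> i j * f i) - (\<Sum>i\<in>UNIV. \<Sum>j\<in>UNIV. adm G i j * \<mu> j i * f i)"
    by (simp add: net_congestion_def sum_distrib_left sum_subtractf algebra_simps)
  also have "(\<Sum>i\<in>UNIV. \<Sum>j\<in>UNIV. adm G i j * \<mu> j i * f i) = (\<Sum>i\<in>UNIV. \<Sum>j\<in>UNIV. adm G i j * \<mu> i j * f j)"
    by (subst sum.swap) (simp add: adm_sym)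
  finally show ?thesis by (simp add: sum_subtractf algebra_simps)
qed

text \<open>The Dirichlet form of the network; the division by 2 compensates for summing over each
  line in both directions.\<close>

lemma sum_laplacian:
  "(\<Sum>i\<in>UNIV. f i * laplacian G g i) = (\<Sum>i\<in>UNIV. \<Sum>j\<in>UNIV. adm G i j * (f i - f j) * (g i - g j)) / 2"
proof -
  have "(\<Sum>i\<in>UNIV. \<Sum>j\<in>UNIV. adm G i j * (f i - f j) * (g i - g j)) =
     (\<Sum>i\<in>UNIV. \<Sum>j\<in>UNIV. adm G i j * f i * (g i - g j)) + (\<Sum>i\<in>UNIV. \<Sum>j\<in>UNIV. adm G i j * f j * (g j - g i))"
    by (simp add: sum_subtractf sum.distrib algebra_simps)
  also have "(\<Sum>i\<in>UNIV. \<Sum>j\<in>UNIV. adm G i j * f j * (g j - g i)) = (\<Sum>i\<in>UNIV. \<Sum>j\<in>UNIV. adm G i j * f i * (g i - g j))"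
    by (subst sum.swap) (simp add: adm_sym)
  finally show ?thesis by (simp add: laplacian_def sum_distrib_left mult_ac)
qed

lemma laplacian_self_adjoint:
  "(\<Sum>i\<in>UNIV. f i * laplacian G g i) = (\<Sum>i\<in>UNIV. g i * laplacian G f i)"
  by (simp add: sum_laplacian mult_ac)

lemma sum_laplacian_eq_0: "(\<Sum>i\<in>UNIV. laplacian G f i) = 0"
  using sum_laplacian[of "\<lambda>_. 1" f] by simp

text \<open>The Dirichlet energy of \<open>f\<close> vanishes and is a sum of non-negative terms, so
  \<open>f\<close> agrees across every line; connectedness does the rest.\<close>

lemma laplacian_eq_0_imp_const:
  assumes "\<And>i. laplacian G f i = 0"
  shows "f i = f j"
proof -
  have "(\<Sum>i\<in>UNIV. \<Sum>j\<in>UNIV. adm G i j * (f i - f j) * (f i - f j)) = 0"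
    using sum_laplacian[of f f] assms by simp
  moreover have "0 \<le> adm G i j * (f i - f j) * (f i - f j)" for i j
    using adm_nonneg[of i j] by (simp add: mult.assoc)
  ultimately have "adm G i j * (f i - f j) * (f i - f j) = 0" for i j
    by (simp add: sum_nonneg_eq_0_iff sum_nonneg)
  hence eq: "f i = f j" if "line G i j" for i j
    using that unfolding line_def by (metis less_irrefl mult_eq_0_iff right_minus_eq)
  show ?thesis
    using connected[of i j] by (induction rule: rtranclp_induct) (auto dest: eq)
qed

text \<open>The Laplacian determines a function up to a constant, and the value at \<open>a\<close>
  fixes the constant. The resulting linear map is injective on a finite-dimensional space, hence
  bounded below.\<close>

lemma laplacian_bound:
  obtains B where "0 \<le> B" "\<And>f k. \<bar>f k\<bar> \<le> B * ((\<Sum>i\<in>UNIV. \<bar>laplacian G f i\<bar>) + \<bar>f a\<bar>)"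
proof -
  define T :: "(real, 'i) vec \<Rightarrow> (real, 'i) vec"
    where "T v = (\<chi> i. laplacian G (\<lambda>i. v $ i) i + (if i = a then v $ a else 0))" for v
  have "linear T"
    by (rule linearI) (auto simp: T_def vec_eq_iff laplacian_add laplacian_scale algebra_simps)
  moreover have "inj T"
  proof (subst linear_injective_0[OF \<open>linear T\<close>], intro allI impI)
    fix v assume "T v = 0"
    hence T0: "laplacian G (\<lambda>i. v $ i) i + (if i = a then v $ a else 0) = 0" for i
      by (simp add: T_def vec_eq_iff)
    \<comment> \<open>Laplacians sum to zero over all nodes, so only the anchoring term
      \<open>v $ a\<close> survives.\<close>
    have "(\<Sum>i\<in>UNIV. laplacian G (\<lambda>i. v $ i) i + (if i = a then v $ a else 0)) = 0"
      by (simp only: T0 sum.neutral_const)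
    hence va: "v $ a = 0" by (simp add: sum.distrib sum_laplacian_eq_0)
    have "laplacian G (\<lambda>i. v $ i) i = 0" for i using T0[of i] va by (simp split: if_splits)
    from laplacian_eq_0_imp_const[OF this] va show "v = 0" by (metis vec_eq_iff zero_index)
  qed
  ultimately obtain b where b: "0 < b" "\<And>v. b * norm v \<le> norm (T v)"
    by (rule linear_inj_bounded_below_pos) blast
  show ?thesis
  proof
    show "0 \<le> inverse b" using b(1) by simp
    fix f :: "'i \<Rightarrow> real" and k
    define v :: "(real, 'i) vec" where "v = (\<chi> i. f i)"
    have "b * \<bar>f k\<bar> \<le> b * norm v"
      using component_le_norm_cart[of v k] b(1) by (simp add: v_def)
    also have "\<dots> \<le> norm (T v)" by (rule b(2))
    also have "\<dots> \<le> (\<Sum>i\<in>UNIV. \<bar>T v $ i\<bar>)" by (rule norm_le_l1_cart)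
    also have "\<dots> \<le> (\<Sum>i\<in>UNIV. \<bar>laplacian G f i\<bar> + (if i = a then \<bar>f a\<bar> else 0))"
      by (intro sum_mono) (auto simp: T_def v_def abs_triangle_ineq)
    also have "\<dots> = (\<Sum>i\<in>UNIV. \<bar>laplacian G f i\<bar>) + \<bar>f a\<bar>" by (simp add: sum.distrib)
    finally show "\<bar>f k\<bar> \<le> inverse b * ((\<Sum>i\<in>UNIV. \<bar>laplacian G f i\<bar>) + \<bar>f a\<bar>)"
      using b(1) by (simp add: field_simps)
  qed
qed

section \<open>The feasible set and existence of an optimal dispatch\<close>

lemma feasible_iff:
  "feasible G x \<theta> \<longleftrightarrow>
     (\<forall>i. (\<Sum>n\<in>generators_at G i. x n) - dem G i = laplacian G \<theta> i) \<and>
     (\<forall>i j. line G i j \<longrightarrow> adm G i j * (\<theta> i - \<theta> j) \<le> cap G i j) \<and>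
     (\<forall>n. 0 \<le> x n)"
  by (simp add: feasible_def laplacian_def)

lemma feasible_sum:
  assumes "feasible G x \<theta>"
  shows "(\<Sum>n\<in>UNIV. x n) = (\<Sum>i\<in>UNIV. dem G i)"
proof -
  have "(\<Sum>i\<in>UNIV. (\<Sum>n\<in>generators_at G i. x n) - dem G i) = (\<Sum>i\<in>UNIV. laplacian G \<theta> i)"
    using assms by (simp add: feasible_iff)
  thus ?thesis by (simp add: sum_subtractf sum_over_nodes sum_laplacian_eq_0)
qed

text \<open>
  Testing stationarity against the phase angles converts the dual constraint into the congestion
  rent, the sum over all lines of multiplier times flow.
\<close>

lemma price_flow_identity:
  assumes "\<And>i. laplacian G \<pi> i + net_congestion G \<mu> i = 0"
    and "feasible G x \<theta>"
  shows "(\<Sum>n\<in>UNIV. \<pi> (loc G n) * x n) + (\<Sum>i\<in>UNIV. \<Sum>j\<in>UNIV. \<mu> i j * (adm G i j * (\<theta> i - \<theta> j)))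
    = (\<Sum>i\<in>UNIV. \<pi> i * dem G i)"
proof -
  have "(\<Sum>n\<in>UNIV. \<pi> (loc G n) * x n) = (\<Sum>i\<in>UNIV. \<Sum>n\<in>generators_at G i. \<pi> (loc G n) * x n)"
    by (simp add: sum_over_nodes)
  also have "\<dots> = (\<Sum>i\<in>UNIV. \<pi> i * (\<Sum>n\<in>generators_at G i. x n))"
    by (simp add: sum_distrib_left generators_at_def)
  also have "\<dots> = (\<Sum>i\<in>UNIV. \<pi> i * (dem G i + laplacian G \<theta> i))"
  proof (intro sum.cong refl)
    fix i
    have "(\<Sum>n\<in>generators_at G i. x n) = dem G i + laplacian G \<theta> i"
      using assms(2) by (simp add: feasible_iff algebra_simps)
    thus "\<pi> i * (\<Sum>n\<in>generators_at G i. x n) = \<pi> i * (dem G i + laplacian G \<theta> i)" by simp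
  qed
  also have "\<dots> = (\<Sum>i\<in>UNIV. \<pi> i * dem G i) + (\<Sum>i\<in>UNIV. \<theta> i * laplacian G \<pi> i)"
    by (simp add: distrib_left sum.distrib laplacian_self_adjoint[of \<theta>])
  also have "(\<Sum>i\<in>UNIV. \<theta> i * laplacian G \<pi> i) = - (\<Sum>i\<in>UNIV. \<theta> i * net_congestion G \<mu> i)"
  proof -
    have "laplacian G \<pi> i = - net_congestion G \<mu> i" for i using assms(1)[of i] by simp
    thus ?thesis by (simp add: sum_negf)
  qed
  finally show ?thesis by (simp add: sum_net_congestion mult_ac)
qed


text \<open>Outputs are non-negative and add up to total demand \<open>D\<close>. Hence the
  Laplacian of the angles has absolute sum at most \<open>2 * D\<close>, and
  \<open>laplacian_bound\<close> controls angles anchored at \<open>a\<close>.\<close>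

lemma feasible_bound:
  obtains C where "\<And>x \<theta> k. feasible G x \<theta> \<Longrightarrow> \<theta> a = 0 \<Longrightarrow> \<bar>\<theta> k\<bar> \<le> C"
    "\<And>x \<theta> n. feasible G x \<theta> \<Longrightarrow> \<bar>x n\<bar> \<le> C"
proof -
  define D where "D = (\<Sum>i\<in>UNIV. dem G i)"
  have x_le: "x n \<le> D" "0 \<le> x n" if "feasible G x \<theta>" for x \<theta> n
  proof -
    have "\<And>n. 0 \<le> x n" using that by (simp add: feasible_iff)
    thus "x n \<le> D" "0 \<le> x n"
      unfolding D_def feasible_sum[OF that, symmetric] by (auto intro: member_le_sum)
  qed
  obtain B where B: "0 \<le> B" "\<And>f k. \<bar>f k\<bar> \<le> B * ((\<Sum>i\<in>UNIV. \<bar>laplacian G f i\<bar>) + \<bar>f a\<bar>)"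
    by (rule laplacian_bound[of a]) blast
  have \<theta>_le: "\<bar>\<theta> k\<bar> \<le> B * (2 * D)" if "feasible G x \<theta>" "\<theta> a = 0" for x \<theta> k
  proof -
    have "(\<Sum>i\<in>UNIV. \<bar>laplacian G \<theta> i\<bar>) \<le> (\<Sum>i\<in>UNIV. (\<Sum>n\<in>generators_at G i. x n) + dem G i)"
    proof (rule sum_mono)
      fix i
      have "laplacian G \<theta> i = (\<Sum>n\<in>generators_at G i. x n) - dem G i"
        using that(1) by (simp add: feasible_iff)
      moreover have "0 \<le> (\<Sum>n\<in>generators_at G i. x n)"
        by (intro sum_nonneg x_le(2)[OF that(1)])
      ultimately show "\<bar>laplacian G \<theta> i\<bar> \<le> (\<Sum>n\<in>generators_at G i. x n) + dem G i"
        using dem_nonneg[of i] by simp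
    qed
    also have "\<dots> = 2 * D"
      using feasible_sum[OF that(1)] by (simp add: sum.distrib sum_over_nodes D_def)
    finally have "(\<Sum>i\<in>UNIV. \<bar>laplacian G \<theta> i\<bar>) + \<bar>\<theta> a\<bar> \<le> 2 * D" using that(2) by simp
    from order_trans[OF B(2)[of \<theta> k] mult_left_mono[OF this B(1)]] show ?thesis .
  qed
  show ?thesis
  proof
    show "\<bar>\<theta> k\<bar> \<le> max (B * (2 * D)) D" if "feasible G x \<theta>" "\<theta> a = 0" for x \<theta> k
      using \<theta>_le[OF that, of k] by simp
    show "\<bar>x n\<bar> \<le> max (B * (2 * D)) D" if "feasible G x \<theta>" for x \<theta> n
      using x_le[OF that, of n] by simp
  qed
qed

lemma optimal_dispatch_exists:
  assumes "feasible G x\<^sub>0 \<theta>\<^sub>0" and cont: "\<And>n. continuous_on {0..} (c n)"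
  obtains x \<theta> where "optimal_dispatch G c x \<theta>"
proof -
  \<comment> \<open>An arbitrary reference node. Feasibility sees only angle differences, so
    shifting the angle at \<open>a\<close> to 0 loses no dispatch and makes the feasible set
    compact.\<close>
  define a where "a = (undefined :: 'i)"
  define K where "K = {v :: (real, 'n) vec \<times> (real, 'i) vec.
    feasible G (\<lambda>n. fst v $ n) (\<lambda>i. snd v $ i) \<and> snd v $ a = 0}"
  have K_shift: "((\<chi> n. x n), (\<chi> i. \<theta> i - \<theta> a)) \<in> K" if "feasible G x \<theta>" for x \<theta>
    using that by (simp add: K_def feasible_def)
  have "K = {v. (\<forall>i. (\<Sum>n\<in>generators_at G i. fst v $ n) - dem G i = laplacian G (\<lambda>i. snd v $ i) i) \<and>
     (\<forall>i j. line G i j \<longrightarrow> adm G i j * (snd v $ i - snd v $ j) \<le> cap G i j) \<and>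
     (\<forall>n. 0 \<le> fst v $ n) \<and> snd v $ a = 0}"
    by (auto simp: K_def feasible_iff)
  also have "closed \<dots>"
    unfolding laplacian_def
    by (intro closed_Collect_conj closed_Collect_all closed_Collect_imp open_Collect_const
        closed_Collect_eq closed_Collect_le continuous_intros)
  finally have "closed K" .
  moreover have "bounded K"
  proof -
    obtain C where C: "\<And>x \<theta> k. feasible G x \<theta> \<Longrightarrow> \<theta> a = 0 \<Longrightarrow> \<bar>\<theta> k\<bar> \<le> C"
      "\<And>x \<theta> n. feasible G x \<theta> \<Longrightarrow> \<bar>x n\<bar> \<le> C" by (rule feasible_bound[of a]) blast
    have "K \<subseteq> cbox (\<chi> n. - C) (\<chi> n. C) \<times> cbox (\<chi> i. - C) (\<chi> i. C)"
    proof
      fix v assume "v \<in> K"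
      hence v: "feasible G (\<lambda>n. fst v $ n) (\<lambda>i. snd v $ i)" "snd v $ a = 0" by (auto simp: K_def)
      have "\<bar>snd v $ k\<bar> \<le> C" "\<bar>fst v $ n\<bar> \<le> C" for k n
        using C(1)[OF v] C(2)[OF v(1)] by auto
      thus "v \<in> cbox (\<chi> n. - C) (\<chi> n. C) \<times> cbox (\<chi> i. - C) (\<chi> i. C)"
        by (auto simp: mem_Times_iff mem_box_cart abs_le_iff minus_le_iff)
    qed
    thus ?thesis by (rule bounded_subset[OF bounded_Times[OF bounded_cbox bounded_cbox]])
  qed
  ultimately have "compact K" by (simp add: compact_eq_bounded_closed)
  moreover have "K \<noteq> {}" using K_shift[OF assms(1)] by blast
  moreover have "continuous_on K (\<lambda>v. \<Sum>n\<in>UNIV. c n (fst v $ n))"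
    by (intro continuous_on_sum continuous_on_compose2[OF cont] continuous_intros)
      (auto simp: K_def feasible_def)
  ultimately obtain v where v: "v \<in> K"
    "\<And>w. w \<in> K \<Longrightarrow> (\<Sum>n\<in>UNIV. c n (fst v $ n)) \<le> (\<Sum>n\<in>UNIV. c n (fst w $ n))"
    using continuous_attains_inf[of K "\<lambda>v. \<Sum>n\<in>UNIV. c n (fst v $ n)"] by blast
  have "optimal_dispatch G c (\<lambda>n. fst v $ n) (\<lambda>i. snd v $ i)"
    unfolding optimal_dispatch_def
  proof (intro conjI allI impI)
    show "feasible G (\<lambda>n. fst v $ n) (\<lambda>i. snd v $ i)" using v(1) by (simp add: K_def)
    fix x' \<theta>' assume "feasible G x' \<theta>'"
    from v(2)[OF K_shift[OF this]]
    show "(\<Sum>n\<in>UNIV. c n (fst v $ n)) \<le> (\<Sum>n\<in>UNIV. c n (x' n))" by simp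
  qed
  thus ?thesis by (rule that)
qed

section \<open>First-order conditions and existence of price multipliers\<close>

text \<open>The direction \<open>(u, \<phi>)\<close> respects all active constraints, so a short
  step \<open>t\<close> along it stays feasible and cannot lower the cost. Convexity bounds the cost
  increment by \<open>t\<close> times the directional slope at the new point; dividing by
  \<open>t\<close> and letting \<open>t\<close> tend to 0 gives the claim by continuity of
  \<open>c'\<close>.\<close>

lemma optimal_dispatch_first_order:
  assumes opt: "optimal_dispatch G c x \<theta>"
    and cont: "\<And>n. continuous_on {0..} (c' n)"
    and tangent: "\<And>n y z. 0 \<le> y \<Longrightarrow> 0 \<le> z \<Longrightarrow> c n y + c' n y * (z - y) \<le> c n z"
    and balance: "\<And>i. (\<Sum>n\<in>generators_at G i. u n) = laplacian G \<phi> i"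
    and flow: "\<And>i j. line G i j \<Longrightarrow> adm G i j * (\<theta> i - \<theta> j) = cap G i j \<Longrightarrow> adm G i j * (\<phi> i - \<phi> j) \<le> 0"
    and nonneg: "\<And>n. x n = 0 \<Longrightarrow> 0 \<le> u n"
  shows "0 \<le> (\<Sum>n\<in>UNIV. c' n (x n) * u n)"
proof -
  have feas: "feasible G x \<theta>"
    and min: "\<And>x' \<theta>'. feasible G x' \<theta>' \<Longrightarrow> (\<Sum>n\<in>UNIV. c n (x n)) \<le> (\<Sum>n\<in>UNIV. c n (x' n))"
    using opt by (auto simp: optimal_dispatch_def)
  have x: "0 \<le> x n" for n using feas by (simp add: feasible_def)
  have ev_x: "\<forall>\<^sub>F t in at_right 0. \<forall>n. 0 \<le> x n + t * u n"
    by (intro eventually_all_finite eventually_at_right_0_nonneg x nonneg)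
  have ev_flow: "\<forall>\<^sub>F t in at_right 0. \<forall>i j. line G i j \<longrightarrow>
      0 \<le> (cap G i j - adm G i j * (\<theta> i - \<theta> j)) + t * (- (adm G i j * (\<phi> i - \<phi> j)))"
  proof (intro eventually_all_finite)
    fix i j
    show "\<forall>\<^sub>F t in at_right 0. line G i j \<longrightarrow>
      0 \<le> (cap G i j - adm G i j * (\<theta> i - \<theta> j)) + t * (- (adm G i j * (\<phi> i - \<phi> j)))"
    proof (cases "line G i j")
      case True
      have "\<forall>\<^sub>F t in at_right 0.
          0 \<le> (cap G i j - adm G i j * (\<theta> i - \<theta> j)) + t * (- (adm G i j * (\<phi> i - \<phi> j)))"
        using True feas flow[OF True]
        by (intro eventually_at_right_0_nonneg) (auto simp: feasible_def)
      thus ?thesis by (simp add: True)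
    qed simp
  qed
  have "\<forall>\<^sub>F t in at_right (0::real). 0 < t" by (rule eventually_at_right_less)
  with ev_x ev_flow have "\<forall>\<^sub>F t in at_right 0. 0 \<le> (\<Sum>n\<in>UNIV. c' n (x n + t * u n) * u n)"
  proof eventually_elim
    case (elim t)
    have "feasible G (\<lambda>n. x n + t * u n) (\<lambda>i. \<theta> i + t * \<phi> i)"
      unfolding feasible_iff
    proof (intro conjI allI impI)
      fix i
      have "(\<Sum>n\<in>generators_at G i. x n + t * u n) = (\<Sum>n\<in>generators_at G i. x n) + t * laplacian G \<phi> i"
        by (simp add: sum.distrib balance[symmetric] sum_distrib_left)
      thus "(\<Sum>n\<in>generators_at G i. x n + t * u n) - dem G i = laplacian G (\<lambda>i. \<theta> i + t * \<phi> i) i"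
        using feas by (simp add: feasible_iff laplacian_add laplacian_scale algebra_simps)
    next
      fix i j assume "line G i j"
      with elim show "adm G i j * (\<theta> i + t * \<phi> i - (\<theta> j + t * \<phi> j)) \<le> cap G i j"
        by (force simp: algebra_simps)
    next
      fix n show "0 \<le> x n + t * u n" using elim by blast
    qed
    from min[OF this] have "0 \<le> (\<Sum>n\<in>UNIV. c n (x n + t * u n) - c n (x n))"
      by (simp add: sum_subtractf)
    also have "\<dots> \<le> (\<Sum>n\<in>UNIV. t * (c' n (x n + t * u n) * u n))"
    proof (rule sum_mono)
      fix n
      show "c n (x n + t * u n) - c n (x n) \<le> t * (c' n (x n + t * u n) * u n)"
        \<comment> \<open>The tangent is taken at the perturbed point, since an upper bound for the
          increment is required; the tangent at \<open>x n\<close> would bound it from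
          below.\<close>
        using tangent[of "x n + t * u n" "x n" n] elim x[of n] by (simp add: algebra_simps)
    qed
    finally show ?case
      using elim by (simp add: sum_distrib_left[symmetric] zero_le_mult_iff)
  qed
  moreover have "((\<lambda>t. \<Sum>n\<in>UNIV. c' n (x n + t * u n) * u n) \<longlongrightarrow> (\<Sum>n\<in>UNIV. c' n (x n) * u n)) (at_right 0)"
  proof (intro tendsto_sum tendsto_mult tendsto_const)
    fix n
    have "((\<lambda>t. x n + t * u n) \<longlongrightarrow> x n + 0 * u n) (at_right 0)" by (intro tendsto_intros)
    hence "((\<lambda>t. x n + t * u n) \<longlongrightarrow> x n) (at_right 0)" by simp
    moreover have "\<forall>\<^sub>F t in at_right 0. x n + t * u n \<in> {0..}"
      using ev_x by (rule eventually_mono) auto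
    ultimately show "((\<lambda>t. c' n (x n + t * u n)) \<longlongrightarrow> c' n (x n)) (at_right 0)"
      using x[of n] by (intro continuous_on_tendsto_compose[OF cont]) auto
  qed
  ultimately show ?thesis
    by (intro tendsto_lowerbound) auto
qed


text \<open>
  Farkas' lemma is applied to the gradients of the balance constraints (with both signs) and of the
  active line and sign constraints; \<open>K\<close> lists the coefficients that the generated cone admits.
\<close>

lemma price_multiplier_exists:
  assumes opt: "optimal_dispatch G c x \<theta>"
    and cont: "\<And>n. continuous_on {0..} (c' n)"
    and tangent: "\<And>n y z. 0 \<le> y \<Longrightarrow> 0 \<le> z \<Longrightarrow> c n y + c' n y * (z - y) \<le> c n z"
  obtains \<pi> \<mu> where "line_multiplier G \<theta> \<pi> \<mu>" "\<And>n. \<pi> (loc G n) \<le> c' n (x n)"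
    "\<And>n. x n \<noteq> 0 \<Longrightarrow> \<pi> (loc G n) = c' n (x n)"
proof -
  \<comment> \<open>Gradients in the variables (outputs, angles). Constraints are read as generation
    minus outflow equal to demand, capacity minus flow non-negative and output non-negative, which
    explains the minus signs in the angle components.\<close>
  define h :: "'i \<Rightarrow> (real, 'n) vec \<times> (real, 'i) vec" where
    "h i = ((\<chi> n. if loc G n = i then 1 else 0), (\<chi> k. - laplacian G (\<lambda>j. if j = i then 1 else 0) k))" for i
  define l :: "'i \<Rightarrow> 'i \<Rightarrow> (real, 'n) vec \<times> (real, 'i) vec" where
    "l i j = (0, (\<chi> k. - net_congestion G (\<lambda>i' j'. if i' = i \<and> j' = j then 1 else 0) k))" for i j
  define e :: "'n \<Rightarrow> (real, 'n) vec \<times> (real, 'i) vec" where "e n = (axis n 1, 0)" for n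
  define active where "active = {(i, j). line G i j \<and> adm G i j * (\<theta> i - \<theta> j) = cap G i j}"
  define S where "S = range h \<union> range (\<lambda>i. - h i) \<union> (\<lambda>(i, j). l i j) ` active \<union> e ` {n. x n = 0}"
  define K :: "((real, 'n) vec \<times> (real, 'i) vec) set" where
    "K = {v. \<exists>\<pi> \<mu>. (\<forall>i j. 0 \<le> \<mu> i j) \<and> (\<forall>i j. line G i j \<longrightarrow> \<mu> i j * (adm G i j * (\<theta> i - \<theta> j) - cap G i j) = 0)
      \<and> (\<forall>n. \<pi> (loc G n) \<le> fst v $ n) \<and> (\<forall>n. x n \<noteq> 0 \<longrightarrow> \<pi> (loc G n) = fst v $ n)
      \<and> (\<forall>k. laplacian G \<pi> k + net_congestion G \<mu> k = - (snd v $ k))}"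
  have KI: "v \<in> K" if "\<And>i j. 0 \<le> \<mu> i j"
      "\<And>i j. line G i j \<Longrightarrow> \<mu> i j * (adm G i j * (\<theta> i - \<theta> j) - cap G i j) = 0"
      "\<And>n. \<pi> (loc G n) \<le> fst v $ n" "\<And>n. x n \<noteq> 0 \<Longrightarrow> \<pi> (loc G n) = fst v $ n"
      "\<And>k. laplacian G \<pi> k + net_congestion G \<mu> k = - (snd v $ k)" for v \<pi> \<mu>
    using that by (auto simp: K_def)
  have zero: "laplacian G (\<lambda>_. 0) k = 0" "net_congestion G (\<lambda>_ _. 0) k = 0" for k
    by (simp_all add: laplacian_def net_congestion_def)
  have h_inner: "h i \<bullet> d = (\<Sum>n\<in>generators_at G i. fst d $ n) - laplacian G (\<lambda>k. snd d $ k) i" for i d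
  proof -
    have "(\<Sum>n\<in>UNIV. (if loc G n = i then 1 else 0) * (fst d $ n)) = (\<Sum>n\<in>generators_at G i. fst d $ n)"
      unfolding generators_at_def by (rule sum.mono_neutral_cong_right) auto
    \<comment> \<open>Self-adjointness moves the Laplacian from the indicator of \<open>i\<close> to
      the angle direction, leaving its value at \<open>i\<close>.\<close>
    moreover have "(\<Sum>k\<in>UNIV. snd d $ k * laplacian G (\<lambda>j. if j = i then 1 else 0) k)
        = laplacian G (\<lambda>k. snd d $ k) i"
      by (subst laplacian_self_adjoint) (simp add: if_distrib[of "\<lambda>t. t * _"] cong: if_cong)
    ultimately show ?thesis
      by (simp add: h_def inner_prod_def inner_vec_def sum_negf mult.commute)
  qed
  have l_inner: "l i j \<bullet> d = - (adm G i j * (snd d $ i - snd d $ j))" for i j d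
  proof -
    have "(\<Sum>k\<in>UNIV. snd d $ k * net_congestion G (\<lambda>i' j'. if i' = i \<and> j' = j then 1 else 0) k)
      = (\<Sum>i'\<in>UNIV. \<Sum>j'\<in>UNIV. if i' = i then (if j' = j then adm G i j * (snd d $ i - snd d $ j) else 0) else 0)"
      unfolding sum_net_congestion by (intro sum.cong refl) auto
    also have "\<dots> = adm G i j * (snd d $ i - snd d $ j)"
      by (simp add: sum.If_cases if_distrib[of "sum _"] cong: if_cong)
    finally show ?thesis
      by (simp add: l_def inner_prod_def inner_vec_def sum_negf mult.commute)
  qed
  have e_inner: "e n \<bullet> d = fst d $ n" for n d
    by (simp add: e_def inner_prod_def inner_axis')
  \<comment> \<open>The gradient of total cost at \<open>x\<close>. Membership in \<open>K\<close>
    turns its zero angle component into the stationarity equation and its output components into the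
    relations between prices and marginal costs.\<close>
  define g :: "(real, 'n) vec \<times> (real, 'i) vec" where "g = ((\<chi> n. c' n (x n)), 0)"
  have "g \<in> convex_cone hull S"
  proof (rule farkas_convex_cone_hull)
    show "finite S" by (simp add: S_def)
    fix d assume d: "\<And>v. v \<in> S \<Longrightarrow> 0 \<le> v \<bullet> d"
    have "0 \<le> (\<Sum>n\<in>UNIV. c' n (x n) * (fst d $ n))"
    proof (rule optimal_dispatch_first_order[OF opt cont tangent])
      show "(\<Sum>n\<in>generators_at G i. fst d $ n) = laplacian G (\<lambda>k. snd d $ k) i" for i
        using d[of "h i"] d[of "- h i"] by (simp add: S_def h_inner)
      show "adm G i j * (snd d $ i - snd d $ j) \<le> 0"
        if "line G i j" "adm G i j * (\<theta> i - \<theta> j) = cap G i j" for i j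
      proof -
        have "l i j \<in> S" using that by (auto simp: S_def active_def)
        from d[OF this] show ?thesis by (simp add: l_inner)
      qed
      show "0 \<le> fst d $ n" if "x n = 0" for n
        using d[of "e n"] that by (simp add: S_def e_inner)
    qed auto
    thus "0 \<le> g \<bullet> d" by (simp add: g_def inner_prod_def inner_vec_def)
  qed
  \<comment> \<open>Each generator of the cone lies in \<open>K\<close> with an indicator, or its
    negative, as coefficient, and \<open>K\<close> is itself a convex cone because coefficients add
    and scale.\<close>
  also have "convex_cone hull S \<subseteq> K"
  proof (rule hull_minimal)
    have "h i \<in> K" for i
      by (rule KI[where \<pi> = "\<lambda>j. if j = i then 1 else 0" and \<mu> = "\<lambda>_ _. 0"])
        (auto simp: h_def zero)
    moreover have "- h i \<in> K" for i
    proof (rule KI[where \<pi> = "\<lambda>j. - 1 * (if j = i then 1 else 0)" and \<mu> = "\<lambda>_ _. 0"])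
      show "laplacian G (\<lambda>j. - 1 * (if j = i then 1 else 0)) k + net_congestion G (\<lambda>_ _. 0) k = - (snd (- h i) $ k)" for k
        unfolding laplacian_scale by (simp add: h_def zero)
    qed (auto simp: h_def)
    moreover have "l i j \<in> K" if "(i, j) \<in> active" for i j
      using that
      by (intro KI[where \<pi> = "\<lambda>_. 0" and \<mu> = "\<lambda>i' j'. if i' = i \<and> j' = j then 1 else 0"])
        (auto simp: l_def zero active_def)
    moreover have "e n \<in> K" if "x n = 0" for n
      using that by (intro KI[where \<pi> = "\<lambda>_. 0" and \<mu> = "\<lambda>_ _. 0"]) (auto simp: e_def zero axis_def)
    ultimately show "S \<subseteq> K" by (auto simp: S_def)
    have "v + w \<in> K" if vw: "v \<in> K" "w \<in> K" for v w
    proof -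
      from vw(1) obtain \<pi> \<mu> where 1: "\<And>i j. 0 \<le> \<mu> i j"
        "\<And>i j. line G i j \<Longrightarrow> \<mu> i j * (adm G i j * (\<theta> i - \<theta> j) - cap G i j) = 0"
        "\<And>n. \<pi> (loc G n) \<le> fst v $ n" "\<And>n. x n \<noteq> 0 \<Longrightarrow> \<pi> (loc G n) = fst v $ n"
        "\<And>k. laplacian G \<pi> k + net_congestion G \<mu> k = - (snd v $ k)" unfolding K_def by auto
      from vw(2) obtain \<rho> \<nu> where 2: "\<And>i j. 0 \<le> \<nu> i j"
        "\<And>i j. line G i j \<Longrightarrow> \<nu> i j * (adm G i j * (\<theta> i - \<theta> j) - cap G i j) = 0"
        "\<And>n. \<rho> (loc G n) \<le> fst w $ n" "\<And>n. x n \<noteq> 0 \<Longrightarrow> \<rho> (loc G n) = fst w $ n"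
        "\<And>k. laplacian G \<rho> k + net_congestion G \<nu> k = - (snd w $ k)" unfolding K_def by auto
      show ?thesis
      proof (rule KI[where \<pi> = "\<lambda>i. \<pi> i + \<rho> i" and \<mu> = "\<lambda>i j. \<mu> i j + \<nu> i j"])
        show "laplacian G (\<lambda>i. \<pi> i + \<rho> i) k + net_congestion G (\<lambda>i j. \<mu> i j + \<nu> i j) k = - (snd (v + w) $ k)" for k
          using 1(5)[of k] 2(5)[of k] by (simp add: laplacian_add net_congestion_add)
        show "(\<mu> i j + \<nu> i j) * (adm G i j * (\<theta> i - \<theta> j) - cap G i j) = 0" if "line G i j" for i j
          using 1(2)[OF that] 2(2)[OF that] by (simp only: distrib_right)
      qed (use 1 2 in \<open>simp_all add: add_mono\<close>)
    qed
    moreover have "t *\<^sub>R v \<in> K" if v: "v \<in> K" and t: "0 \<le> t" for t v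
    proof -
      from v obtain \<pi> \<mu> where 1: "\<And>i j. 0 \<le> \<mu> i j"
        "\<And>i j. line G i j \<Longrightarrow> \<mu> i j * (adm G i j * (\<theta> i - \<theta> j) - cap G i j) = 0"
        "\<And>n. \<pi> (loc G n) \<le> fst v $ n" "\<And>n. x n \<noteq> 0 \<Longrightarrow> \<pi> (loc G n) = fst v $ n"
        "\<And>k. laplacian G \<pi> k + net_congestion G \<mu> k = - (snd v $ k)" unfolding K_def by auto
      show ?thesis
      proof (rule KI[where \<pi> = "\<lambda>i. t * \<pi> i" and \<mu> = "\<lambda>i j. t * \<mu> i j"])
        show "laplacian G (\<lambda>i. t * \<pi> i) k + net_congestion G (\<lambda>i j. t * \<mu> i j) k = - (snd (t *\<^sub>R v) $ k)" for k
          using 1(5)[of k] by (simp add: laplacian_scale net_congestion_scale distrib_left[symmetric])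
        show "t * \<mu> i j * (adm G i j * (\<theta> i - \<theta> j) - cap G i j) = 0" if "line G i j" for i j
          using 1(2)[OF that] by simp
      qed (use 1 t in \<open>simp_all add: mult_left_mono\<close>)
    qed
    moreover have "0 \<in> K" by (rule KI[where \<pi> = "\<lambda>_. 0" and \<mu> = "\<lambda>_ _. 0"]) (auto simp: zero)
    ultimately show "convex_cone K" by (simp add: convex_cone_iff)
  qed
  finally obtain \<pi> \<mu> where "\<And>i j. 0 \<le> \<mu> i j"
    "\<And>i j. line G i j \<Longrightarrow> \<mu> i j * (adm G i j * (\<theta> i - \<theta> j) - cap G i j) = 0"
    "\<And>n. \<pi> (loc G n) \<le> c' n (x n)" "\<And>n. x n \<noteq> 0 \<Longrightarrow> \<pi> (loc G n) = c' n (x n)"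
    "\<And>k. laplacian G \<pi> k + net_congestion G \<mu> k = 0" unfolding K_def g_def by auto
  thus ?thesis by (intro that[of \<pi> \<mu>]) (auto simp: line_multiplier_def)
qed

end

section \<open>Linear bids and the prices supporting them\<close>

definition flat_bid :: "real \<Rightarrow> bid" where
  "flat_bid p = \<lparr>bid_p = p, bid_s = 0, bid_q = p\<rparr>"

lemma bid_fun_flat_bid [simp]: "bid_fun (flat_bid p) = (\<lambda>y. p * y)"
  by (simp add: fun_eq_iff bid_fun_def flat_bid_def)

lemma valid_bid_flat_bid [simp]: "valid_bid (flat_bid p) \<longleftrightarrow> 0 \<le> p"
  by (auto simp: valid_bid_def flat_bid_def)

lemma linear_has_derivative_iff:
  fixes p y :: real
  assumes "at y within A \<noteq> bot"
  shows "((\<lambda>y. p * y) has_real_derivative D) (at y within A) \<longleftrightarrow> D = p"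
proof
  assume "((\<lambda>y. p * y) has_real_derivative D) (at y within A)"
  moreover have "((\<lambda>y. p * y) has_real_derivative p) (at y within A)"
    by (auto intro!: derivative_eq_intros)
  ultimately show "D = p"
    unfolding has_field_derivative_iff using assms by (metis tendsto_unique)
qed (auto intro!: derivative_eq_intros)

text \<open>The right derivative of a linear bid is \<open>p\<close> at every output, so the price
  is capped whatever the other generators bid. This is how a competitor at the same node disciplines
  a deviator.\<close>

lemma price_le_flat_bid:
  assumes "price_multiplier G b x \<theta> \<pi>" "b n = flat_bid p" "0 \<le> x n"
  shows "\<pi> (loc G n) \<le> p"
proof (cases "x n = 0")
  case True
  with assms(1) show ?thesis
    by (force simp: price_multiplier_def assms(2) linear_has_derivative_iff)
next
  case False
  with assms(3) have "0 < x n" by simp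
  with assms(1) obtain r where
    "(bid_fun (b n) has_real_derivative r) (at_right (x n))" "\<pi> (loc G n) \<le> r"
    unfolding price_multiplier_def by blast
  thus ?thesis by (simp add: assms(2) linear_has_derivative_iff)
qed

text \<open>Left and right derivatives of a linear bid coincide, so the derivative clauses reduce to
  complementary slackness between the output and the gap
  \<open>p n - \<pi> (loc G n)\<close>.\<close>

lemma price_multiplier_flat_bids:
  assumes "\<And>n. 0 \<le> x n"
  shows "price_multiplier G (\<lambda>n. flat_bid (p n)) x \<theta> \<pi> \<longleftrightarrow>
    (\<forall>n. \<pi> (loc G n) \<le> p n) \<and> (\<forall>n. x n \<noteq> 0 \<longrightarrow> \<pi> (loc G n) = p n) \<and> (\<exists>\<mu>. line_multiplier G \<theta> \<pi> \<mu>)"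
proof -
  have "(\<Sum>j\<in>UNIV. adm G i j * (\<pi> i - \<pi> j + \<mu> i j - \<mu> j i)) = laplacian G \<pi> i + net_congestion G \<mu> i" for \<mu> i
    by (simp add: laplacian_def net_congestion_def sum.distrib[symmetric] algebra_simps)
  hence "price_multiplier G (\<lambda>n. flat_bid (p n)) x \<theta> \<pi> \<longleftrightarrow>
      (\<forall>n. 0 < x n \<longrightarrow> p n \<le> \<pi> (loc G n) \<and> \<pi> (loc G n) \<le> p n) \<and>
      (\<forall>n. x n = 0 \<longrightarrow> \<pi> (loc G n) \<le> p n) \<and> (\<exists>\<mu>. line_multiplier G \<theta> \<pi> \<mu>)"
    unfolding price_multiplier_def line_multiplier_def by (simp add: linear_has_derivative_iff)
  moreover have "(0 < x n \<longrightarrow> p n \<le> \<pi> (loc G n) \<and> \<pi> (loc G n) \<le> p n) \<and> (x n = 0 \<longrightarrow> \<pi> (loc G n) \<le> p n) \<longleftrightarrow>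
      \<pi> (loc G n) \<le> p n \<and> (x n \<noteq> 0 \<longrightarrow> \<pi> (loc G n) = p n)" for n
    using assms[of n] by auto
  ultimately show ?thesis by blast
qed

section \<open>Optimality under linear bids and compactness of the price set\<close>

context power_network
begin

text \<open>Weak duality. By complementary slackness \<open>\<theta>\<close> maximises the
  congestion rent among feasible angles, so by \<open>price_flow_identity\<close> the dispatch
  \<open>x\<close> minimises output valued at \<open>\<pi>\<close>. Replacing \<open>\<pi>\<close>
  by \<open>p\<close> leaves the cost of \<open>x\<close> unchanged and can only raise that of a
  competitor.\<close>

lemma flat_bids_optimal_dispatch:
  assumes feas: "feasible G x \<theta>" and mult: "line_multiplier G \<theta> \<pi> \<mu>"
    and le: "\<And>n. \<pi> (loc G n) \<le> p n" and eq: "\<And>n. x n \<noteq> 0 \<Longrightarrow> \<pi> (loc G n) = p n"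
  shows "optimal_dispatch G (\<lambda>n y. p n * y) x \<theta>"
  unfolding optimal_dispatch_def
proof (intro conjI allI impI feas)
  fix x' \<theta>' assume feas': "feasible G x' \<theta>'"
  have stat: "\<And>i. laplacian G \<pi> i + net_congestion G \<mu> i = 0"
    using mult by (simp add: line_multiplier_def)
  have "(\<Sum>i\<in>UNIV. \<Sum>j\<in>UNIV. \<mu> i j * (adm G i j * (\<theta>' i - \<theta>' j)))
      \<le> (\<Sum>i\<in>UNIV. \<Sum>j\<in>UNIV. \<mu> i j * (adm G i j * (\<theta> i - \<theta> j)))"
  proof (intro sum_mono)
    fix i j
    show "\<mu> i j * (adm G i j * (\<theta>' i - \<theta>' j)) \<le> \<mu> i j * (adm G i j * (\<theta> i - \<theta> j))"
    proof (cases "line G i j")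
      case True
      have "0 \<le> \<mu> i j" "\<mu> i j * (adm G i j * (\<theta> i - \<theta> j) - cap G i j) = 0"
        using mult True by (simp_all add: line_multiplier_def)
      moreover have "adm G i j * (\<theta>' i - \<theta>' j) \<le> cap G i j" using feas' True by (simp add: feasible_def)
      ultimately show ?thesis
        using mult_left_mono[of "adm G i j * (\<theta>' i - \<theta>' j)" "cap G i j" "\<mu> i j"]
        by (simp add: right_diff_distrib)
    qed (simp add: adm_eq_0)
  qed
  hence "(\<Sum>n\<in>UNIV. \<pi> (loc G n) * x n) \<le> (\<Sum>n\<in>UNIV. \<pi> (loc G n) * x' n)"
    using price_flow_identity[OF stat feas] price_flow_identity[OF stat feas'] by linarith
  moreover have "(\<Sum>n\<in>UNIV. p n * x n) = (\<Sum>n\<in>UNIV. \<pi> (loc G n) * x n)"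
    by (intro sum.cong refl) (use eq in fastforce)
  moreover have "(\<Sum>n\<in>UNIV. \<pi> (loc G n) * x' n) \<le> (\<Sum>n\<in>UNIV. p n * x' n)"
    using feas' by (intro sum_mono mult_right_mono le) (simp add: feasible_def)
  ultimately show "(\<Sum>n\<in>UNIV. p n * x n) \<le> (\<Sum>n\<in>UNIV. p n * x' n)" by linarith
qed

text \<open>
  By the price-flow identity the congestion rent is at most the excess of the consumers' payment
  over the generators' revenue. Hence the line multipliers are bounded, and then so are the prices,
  because one of them is fixed by a generator with positive output.
\<close>

lemma compact_price_multipliers:
  assumes feas: "feasible G x \<theta>" and gen: "\<And>i. generators_at G i \<noteq> {}" and dem: "dem G i\<^sub>0 \<noteq> 0"
  shows "compact {v. price_multiplier G (\<lambda>n. flat_bid (P (loc G n))) x \<theta> (\<lambda>i. v $ i)}"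
proof -
  have x: "0 \<le> x n" for n using feas by (simp add: feasible_def)
  \<comment> \<open>Pairs of prices and line multipliers, whose projection to prices is the set in
    question. Multipliers on pairs without a line are set to 0: they have weight
    \<open>adm G i j = 0\<close> in the stationarity equation, but left free they would make
    \<open>Q\<close> unbounded.\<close>
  define Q where "Q = {w :: (real, 'i) vec \<times> ((real, 'i) vec, 'i) vec.
    (\<forall>n. fst w $ loc G n \<le> P (loc G n)) \<and> (\<forall>n. x n \<noteq> 0 \<longrightarrow> fst w $ loc G n = P (loc G n)) \<and>
    (\<forall>i j. snd w $ i $ j \<ge> 0) \<and>
    (\<forall>i. laplacian G (\<lambda>i. fst w $ i) i + net_congestion G (\<lambda>i j. snd w $ i $ j) i = 0) \<and>
    (\<forall>i j. line G i j \<longrightarrow> snd w $ i $ j * (adm G i j * (\<theta> i - \<theta> j) - cap G i j) = 0) \<and>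
    (\<forall>i j. \<not> line G i j \<longrightarrow> snd w $ i $ j = 0)}"
  have image_eq: "{v. price_multiplier G (\<lambda>n. flat_bid (P (loc G n))) x \<theta> (\<lambda>i. v $ i)} = fst ` Q"
  proof (intro equalityI subsetI)
    fix v assume "v \<in> {v. price_multiplier G (\<lambda>n. flat_bid (P (loc G n))) x \<theta> (\<lambda>i. v $ i)}"
    then obtain \<mu> where v: "\<forall>n. v $ loc G n \<le> P (loc G n)" "\<forall>n. x n \<noteq> 0 \<longrightarrow> v $ loc G n = P (loc G n)"
      and \<mu>: "line_multiplier G \<theta> (\<lambda>i. v $ i) \<mu>"
      by (auto simp: price_multiplier_flat_bids[OF x])
    have "net_congestion G (\<lambda>i j. if line G i j then \<mu> i j else 0) i = net_congestion G \<mu> i" for i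
      unfolding net_congestion_def using adm_eq_0 adm_sym
      by (intro sum.cong refl) (auto simp: line_def)
    hence "(v, \<chi> i j. if line G i j then \<mu> i j else 0) \<in> Q"
      using v \<mu> by (auto simp: Q_def line_multiplier_def vec_lambda_inverse)
    thus "v \<in> fst ` Q" by force
  next
    fix v assume "v \<in> fst ` Q"
    then obtain m where "(v, m) \<in> Q" by force
    hence "line_multiplier G \<theta> (\<lambda>i. v $ i) (\<lambda>i j. m $ i $ j)"
      and "\<forall>n. v $ loc G n \<le> P (loc G n)" "\<forall>n. x n \<noteq> 0 \<longrightarrow> v $ loc G n = P (loc G n)"
      by (simp_all add: Q_def line_multiplier_def)
    thus "v \<in> {v. price_multiplier G (\<lambda>n. flat_bid (P (loc G n))) x \<theta> (\<lambda>i. v $ i)}"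
      by (auto simp: price_multiplier_flat_bids[OF x])
  qed
  have "closed Q"
    unfolding Q_def laplacian_def net_congestion_def
    by (intro closed_Collect_conj closed_Collect_all closed_Collect_imp open_Collect_const
        closed_Collect_eq closed_Collect_le continuous_intros)
  moreover have "bounded Q"
  proof -
    have "\<exists>n. x n \<noteq> 0"
    proof (rule ccontr)
      assume "\<nexists>n. x n \<noteq> 0"
      hence "(\<Sum>i\<in>UNIV. dem G i) = 0" using feasible_sum[OF feas] by simp
      with dem dem_nonneg show False by (simp add: sum_nonneg_eq_0_iff)
    qed
    then obtain m where m: "x m \<noteq> 0" by blast
    \<comment> \<open>\<open>R\<close> bounds the congestion rent: every node has a generator, so
      prices are at most \<open>P\<close>, and they equal \<open>P\<close> wherever output is
      nonzero. Then \<open>U\<close> bounds each multiplier, since its share of the rent is at most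
      \<open>R\<close>; \<open>V\<close> bounds the Laplacian of the prices; and \<open>C\<close>
      below bounds the prices, anchored at the node of \<open>m\<close>.\<close>
    define R where "R = (\<Sum>i\<in>UNIV. P i * dem G i) - (\<Sum>n\<in>UNIV. P (loc G n) * x n)"
    define U where "U i j = (if line G i j then R / cap G i j else 0)" for i j
    define V where "V i = (\<Sum>j\<in>UNIV. adm G i j * (U i j + U j i))" for i
    obtain B where B: "0 \<le> B"
      "\<And>f k. \<bar>f k\<bar> \<le> B * ((\<Sum>i\<in>UNIV. \<bar>laplacian G f i\<bar>) + \<bar>f (loc G m)\<bar>)"
      by (rule laplacian_bound[of "loc G m"]) blast
    define C where "C = B * ((\<Sum>i\<in>UNIV. V i) + \<bar>P (loc G m)\<bar>)"
    have bound: "0 \<le> snd w $ i $ j" "snd w $ i $ j \<le> U i j" "\<bar>fst w $ i\<bar> \<le> C" if w: "w \<in> Q" for w i j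
    proof -
      define \<pi> where "\<pi> = (\<lambda>i. fst w $ i)"
      define \<mu> where "\<mu> = (\<lambda>i j. snd w $ i $ j)"
      have \<pi>: "\<pi> (loc G n) \<le> P (loc G n)" "x n \<noteq> 0 \<Longrightarrow> \<pi> (loc G n) = P (loc G n)"
        and \<mu>: "0 \<le> \<mu> i j" "laplacian G \<pi> i + net_congestion G \<mu> i = 0"
          "line G i j \<Longrightarrow> \<mu> i j * (adm G i j * (\<theta> i - \<theta> j) - cap G i j) = 0"
          "\<not> line G i j \<Longrightarrow> \<mu> i j = 0" for n i j
        using w by (simp_all add: Q_def \<pi>_def \<mu>_def)
      have rent: "\<mu> i j * (adm G i j * (\<theta> i - \<theta> j)) = \<mu> i j * cap G i j" for i j
        using \<mu>(3,4)[of i j] by (cases "line G i j") (auto simp: right_diff_distrib)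
      have rent_nonneg: "0 \<le> \<mu> i j * cap G i j" for i j
        using \<mu>(1,4)[of i j] cap_pos[of i j] by (cases "line G i j") auto
      have "(\<Sum>i\<in>UNIV. \<Sum>j\<in>UNIV. \<mu> i j * cap G i j) = (\<Sum>i\<in>UNIV. \<pi> i * dem G i) - (\<Sum>n\<in>UNIV. \<pi> (loc G n) * x n)"
        using price_flow_identity[OF \<mu>(2) feas] by (simp add: rent)
      also have "(\<Sum>n\<in>UNIV. \<pi> (loc G n) * x n) = (\<Sum>n\<in>UNIV. P (loc G n) * x n)"
        by (intro sum.cong refl) (use \<pi>(2) in fastforce)
      also have "(\<Sum>i\<in>UNIV. \<pi> i * dem G i) \<le> (\<Sum>i\<in>UNIV. P i * dem G i)"
      proof (intro sum_mono mult_right_mono dem_nonneg)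
        fix i
        obtain n where "loc G n = i" using gen[of i] by (auto simp: generators_at_def)
        thus "\<pi> i \<le> P i" using \<pi>(1)[of n] by simp
      qed
      finally have total: "(\<Sum>i\<in>UNIV. \<Sum>j\<in>UNIV. \<mu> i j * cap G i j) \<le> R" by (simp add: R_def)
      have \<mu>U: "\<mu> i j \<le> U i j" for i j
      proof (cases "line G i j")
        case True
        have "\<mu> i j * cap G i j \<le> (\<Sum>j\<in>UNIV. \<mu> i j * cap G i j)"
          by (intro member_le_sum) (auto simp: rent_nonneg)
        also have "\<dots> \<le> (\<Sum>i\<in>UNIV. \<Sum>j\<in>UNIV. \<mu> i j * cap G i j)"
          by (intro member_le_sum[where f = "\<lambda>i. \<Sum>j\<in>UNIV. \<mu> i j * cap G i j"])
            (auto simp: rent_nonneg sum_nonneg)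
        also note total
        finally show ?thesis using cap_pos[OF True] True by (simp add: U_def pos_le_divide_eq)
      qed (simp add: U_def \<mu>(4))
      have "\<bar>laplacian G \<pi> i\<bar> \<le> V i" for i
      proof -
        have "laplacian G \<pi> i = - net_congestion G \<mu> i" using \<mu>(2)[of i] by simp
        hence "\<bar>laplacian G \<pi> i\<bar> \<le> (\<Sum>j\<in>UNIV. \<bar>adm G i j * (\<mu> i j - \<mu> j i)\<bar>)"
          by (simp add: net_congestion_def sum_abs)
        also have "\<dots> \<le> V i"
          unfolding V_def
        proof (rule sum_mono)
          fix j
          have "\<bar>\<mu> i j - \<mu> j i\<bar> \<le> U i j + U j i"
            using \<mu>(1)[of i j] \<mu>(1)[of j i] \<mu>U[of i j] \<mu>U[of j i] by linarith
          thus "\<bar>adm G i j * (\<mu> i j - \<mu> j i)\<bar> \<le> adm G i j * (U i j + U j i)"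
            using adm_nonneg[of i j] by (simp add: abs_mult mult_left_mono)
        qed
        finally show ?thesis .
      qed
      hence "(\<Sum>i\<in>UNIV. \<bar>laplacian G \<pi> i\<bar>) + \<bar>\<pi> (loc G m)\<bar> \<le> (\<Sum>i\<in>UNIV. V i) + \<bar>P (loc G m)\<bar>"
        using \<pi>(2)[OF m] by (simp add: sum_mono)
      from order_trans[OF B(2) mult_left_mono[OF this B(1)]]
      have "\<bar>\<pi> i\<bar> \<le> C" for i by (simp add: C_def)
      with \<mu>U \<mu>(1) show "0 \<le> snd w $ i $ j" "snd w $ i $ j \<le> U i j" "\<bar>fst w $ i\<bar> \<le> C"
        by (simp_all add: \<pi>_def \<mu>_def)
    qed
    have "norm w \<le> (\<Sum>i\<in>(UNIV :: 'i set). C) + (\<Sum>i\<in>UNIV. \<Sum>j\<in>UNIV. U i j)" if "w \<in> Q" for w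
    proof -
      have "norm w \<le> norm (fst w) + norm (snd w)"
        using norm_Pair_le[of "fst w" "snd w"] by simp
      moreover have "norm (fst w) \<le> (\<Sum>i\<in>UNIV. \<bar>fst w $ i\<bar>)" by (rule norm_le_l1_cart)
      moreover have "(\<Sum>i\<in>UNIV. \<bar>fst w $ i\<bar>) \<le> (\<Sum>i\<in>(UNIV :: 'i set). C)"
        by (intro sum_mono bound(3)[OF that])
      moreover have "norm (snd w) \<le> (\<Sum>i\<in>UNIV. norm (snd w $ i))"
        unfolding norm_vec_def by (rule L2_set_le_sum) simp
      moreover have "(\<Sum>i\<in>UNIV. norm (snd w $ i)) \<le> (\<Sum>i\<in>UNIV. \<Sum>j\<in>UNIV. U i j)"
      proof (rule sum_mono)
        fix i
        have "norm (snd w $ i) \<le> (\<Sum>j\<in>UNIV. \<bar>snd w $ i $ j\<bar>)" by (rule norm_le_l1_cart)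
        also have "\<dots> \<le> (\<Sum>j\<in>UNIV. U i j)"
          using bound(1,2)[OF that] by (intro sum_mono) simp
        finally show "norm (snd w $ i) \<le> (\<Sum>j\<in>UNIV. U i j)" .
      qed
      ultimately show ?thesis by linarith
    qed
    thus ?thesis by (rule boundedI)
  qed
  ultimately have "compact Q" by (simp add: compact_eq_bounded_closed)
  thus ?thesis
    unfolding image_eq by (intro compact_continuous_image continuous_on_fst continuous_on_id)
qed

end

section \<open>The efficient equilibrium\<close>

theorem theorem2:
  fixes G :: "('i::{finite,linorder}, 'n::finite) network"
    and c :: "'n \<Rightarrow> real \<Rightarrow> real"
  assumes "connected_power_network G"
    and "\<And>n. cost_function (c n)"
    and "\<And>n\<^sub>0. \<exists>x \<theta>. feasible G x \<theta> \<and> x n\<^sub>0 = 0"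
    and "\<And>i. card (generators_at G i) \<ge> 2"
  shows "\<exists>b x \<pi>. nash_equilibrium G c b x \<pi> \<and> efficient G c x"
proof -
  interpret power_network G by unfold_locales (rule assms(1))
  have "\<forall>n. \<exists>c'. continuous_on {0..} (c n) \<and> continuous_on {0..} c' \<and> (\<forall>y\<ge>0. 0 \<le> c' y) \<and>
      (\<forall>y z. 0 \<le> y \<longrightarrow> 0 \<le> z \<longrightarrow> c n y + c' y * (z - y) \<le> c n z)"
  proof
    fix n
    show "\<exists>c'. continuous_on {0..} (c n) \<and> continuous_on {0..} c' \<and> (\<forall>y\<ge>0. 0 \<le> c' y) \<and>
      (\<forall>y z. 0 \<le> y \<longrightarrow> 0 \<le> z \<longrightarrow> c n y + c' y * (z - y) \<le> c n z)"
      by (rule cost_function_tangent[OF assms(2)[of n]]) blast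
  qed
  from choice[OF this] obtain c' where c': "\<forall>n. continuous_on {0..} (c n) \<and> continuous_on {0..} (c' n) \<and>
      (\<forall>y\<ge>0. 0 \<le> c' n y) \<and> (\<forall>y z. 0 \<le> y \<longrightarrow> 0 \<le> z \<longrightarrow> c n y + c' n y * (z - y) \<le> c n z)" by blast
  hence cont: "continuous_on {0..} (c n)" and cont': "continuous_on {0..} (c' n)"
    and c'_nonneg: "0 \<le> y \<Longrightarrow> 0 \<le> c' n y"
    and tangent: "0 \<le> y \<Longrightarrow> 0 \<le> z \<Longrightarrow> c n y + c' n y * (z - y) \<le> c n z" for n y z
    by simp_all
  obtain x \<theta> where opt: "optimal_dispatch G c x \<theta>"
  proof -
    obtain x\<^sub>0 \<theta>\<^sub>0 where "feasible G x\<^sub>0 \<theta>\<^sub>0"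
      using assms(3)[of undefined] by blast
    from optimal_dispatch_exists[where c = c, OF this cont] show ?thesis using that by blast
  qed
  hence feas: "feasible G x \<theta>" by (simp add: optimal_dispatch_def)
  hence x: "0 \<le> x n" for n by (simp add: feasible_def)
  obtain \<pi> \<mu> where mult: "line_multiplier G \<theta> \<pi> \<mu>" and \<pi>_le: "\<And>n. \<pi> (loc G n) \<le> c' n (x n)"
    and \<pi>_eq: "\<And>n. x n \<noteq> 0 \<Longrightarrow> \<pi> (loc G n) = c' n (x n)"
    by (rule price_multiplier_exists[where c = c and c' = c', OF opt cont' tangent]) auto
  \<comment> \<open>The truncation makes the bids valid, as slopes must be non-negative. Marginal
    costs are non-negative too, so \<open>P\<close> still lies below them, with equality at
    producing generators.\<close>
  define P where "P i = max (\<pi> i) 0" for i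
  define b where "b = (\<lambda>n. flat_bid (P (loc G n)))"
  have P_le: "\<pi> (loc G n) \<le> P (loc G n)" for n by (simp add: P_def)
  have P_eq: "x n \<noteq> 0 \<Longrightarrow> \<pi> (loc G n) = P (loc G n)" for n
    using c'_nonneg[OF x] \<pi>_eq by (simp add: P_def)
  have P_c': "P (loc G n) \<le> c' n (x n)" "x n \<noteq> 0 \<Longrightarrow> P (loc G n) = c' n (x n)" for n
    using c'_nonneg[OF x] \<pi>_le \<pi>_eq by (simp_all add: P_def)
  have gen: "generators_at G i \<noteq> {}" for i using assms(4)[of i] by auto
  have bid_opt: "optimal_dispatch G (\<lambda>n. bid_fun (b n)) x \<theta>"
    using flat_bids_optimal_dispatch[OF feas mult P_le P_eq] by (simp add: b_def)
  have pm: "price_multiplier G b x \<theta> \<pi>"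
    unfolding b_def price_multiplier_flat_bids[OF x] using mult P_le P_eq by blast
  have "\<exists>\<rho>. is_lmp G b x \<theta> \<rho>"
  \<comment> \<open>With zero demand \<open>is_lmp\<close> accepts every multiplier, so
    \<open>\<pi>\<close> itself serves; otherwise compactness supplies the lexicographically least
    one.\<close>
  proof (cases "\<forall>i. dem G i = 0")
    case True
    thus ?thesis using pm by (auto simp: is_lmp_def)
  next
    case False
    then obtain i\<^sub>0 where "dem G i\<^sub>0 \<noteq> 0" by blast
    define K where "K = {v. price_multiplier G b x \<theta> (\<lambda>i. v $ i)}"
    have "compact K"
      unfolding K_def b_def using feas gen \<open>dem G i\<^sub>0 \<noteq> 0\<close> by (rule compact_price_multipliers)
    moreover have "(\<chi> i. \<pi> i) \<in> K" using pm by (simp add: K_def vec_lambda_inverse)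
    ultimately obtain v where v: "lex_least ((\<lambda>v i. v $ i) ` K) (\<lambda>i. v $ i)"
      using compact_imp_lex_least[of K] by blast
    have "(\<lambda>v i. v $ i) ` K = {\<rho>. price_multiplier G b x \<theta> \<rho>}"
    proof (intro equalityI subsetI)
      fix \<rho> assume "\<rho> \<in> {\<rho>. price_multiplier G b x \<theta> \<rho>}"
      hence "(\<chi> i. \<rho> i) \<in> K" by (simp add: K_def vec_lambda_inverse)
      thus "\<rho> \<in> (\<lambda>v i. v $ i) ` K" by (rule rev_image_eqI) (simp add: vec_lambda_inverse)
    qed (auto simp: K_def)
    with v False show ?thesis by (auto simp: is_lmp_def)
  qed
  then obtain \<rho> where \<rho>: "is_lmp G b x \<theta> \<rho>" by blast
  have is_lmp_imp: "price_multiplier G b' x' \<theta>' \<pi>'" if "is_lmp G b' x' \<theta>' \<pi>'" for b' x' \<theta>' \<pi>'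
    using that by (auto simp: is_lmp_def lex_least_def split: if_splits)
  \<comment> \<open>The price enters a payoff only multiplied by output, and where output is nonzero
    the selected \<open>\<rho>\<close> agrees with \<open>P\<close>.\<close>
  have payoff_eq: "payoff G c x \<rho> n = P (loc G n) * x n - c n (x n)" for n
    using is_lmp_imp[OF \<rho>] unfolding b_def price_multiplier_flat_bids[OF x] payoff_def by auto
  have "nash_equilibrium G c b x \<rho>"
    unfolding nash_equilibrium_def
  proof (intro conjI allI impI)
    show "valid_bid (b n)" for n by (simp add: b_def P_def)
    show "outcome G b x \<rho>" using bid_opt \<rho> by (auto simp: outcome_def)
    fix n \<beta> x' \<pi>' assume "valid_bid \<beta> \<and> outcome G (b(n := \<beta>)) x' \<pi>'"
    then obtain \<theta>' where feas': "feasible G x' \<theta>'" and pm': "price_multiplier G (b(n := \<beta>)) x' \<theta>' \<pi>'"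
      using is_lmp_imp by (auto simp: outcome_def optimal_dispatch_def)
    have x': "0 \<le> x' k" for k using feas' by (simp add: feasible_def)
    obtain m where m: "m \<noteq> n" "loc G m = loc G n"
    proof -
      have "\<not> generators_at G (loc G n) \<subseteq> {n}"
        using assms(4)[of "loc G n"] card_mono[of "{n}" "generators_at G (loc G n)"] by auto
      thus ?thesis using that by (auto simp: generators_at_def)
    qed
    have "\<pi>' (loc G n) \<le> P (loc G n)"
      using price_le_flat_bid[OF pm', of m "P (loc G n)"] m x' by (simp add: b_def)
    hence "\<pi>' (loc G n) * x' n \<le> P (loc G n) * x' n" by (intro mult_right_mono x')
    \<comment> \<open>If \<open>x n = 0\<close>, the deviation can only raise output and
      \<open>P\<close> is at most marginal cost; otherwise the two slopes are equal and the sign of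
      the change is immaterial.\<close>
    moreover have "P (loc G n) * (x' n - x n) \<le> c' n (x n) * (x' n - x n)"
      using P_c'[of n] x'[of n] by (cases "x n = 0") (auto intro: mult_right_mono)
    moreover have "c n (x n) + c' n (x n) * (x' n - x n) \<le> c n (x' n)" by (intro tangent x x')
    ultimately show "payoff G c x' \<pi>' n \<le> payoff G c x \<rho> n"
      unfolding payoff_eq by (simp add: payoff_def right_diff_distrib)
  qed
  moreover have "efficient G c x" using opt by (auto simp: efficient_def)
  ultimately show ?thesis by blast
qed

end
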